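(* Let $\mathcal{A}$ be an irreducible $3\times 3$ sign pattern. Say that $\mathcal{A}$ is exceptional if, up to permutation similarity, $\mathcal{A}$ is a star sign pattern with no non-centre loops and with oppositely signed $2$-cycles; that is, after a simultaneous permutation of rows and columns, $\mathcal{A}_{22}=\mathcal{A}_{33}=\mathcal{A}_{23}=\mathcal{A}_{32}=0$, the entries $\mathcal{A}_{12},\mathcal{A}_{21},\mathcal{A}_{13},\mathcal{A}_{31}$ are all nonzero, and the sign products $\mathcal{A}_{12}\mathcal{A}_{21}$ and $\mathcal{A}_{13}\mathcal{A}_{31}$ are opposite (with $\mathcal{A}_{11}\in\{0,+,-\}$ arbitrary). If $\mathcal{A}$ is not exceptional, then $\mathcal{A}$ requires the nSMP. If $\mathcal{A}$ is exceptional, then $\mathcal{A}$ allows the nSMP but does not require the nSMP.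
   Context: A real $n\times n$ matrix $A$ has the non-symmetric strong multiplicity property (nSMP) if the only real $n\times n$ matrix $X$ satisfying all of (1) $A\circ X=O$ (entrywise product), (2) $AX^T-X^TA=O$, and (3) $\mathrm{tr}(X^TA^k)=0$ for all $0\le k<n$, is $X=O$ (the zero matrix). A sign pattern is an $n\times n$ matrix $\mathcal{A}$ with entries in $\{+,-,0\}$; $Q(\mathcal{A})$ is the set of real $n\times n$ matrices $A$ with $A_{ij}>0$ if $\mathcal{A}_{ij}=+$, $A_{ij}<0$ if $\mathcal{A}_{ij}=-$, and $A_{ij}=0$ if $\mathcal{A}_{ij}=0$. The pattern $\mathcal{A}$ allows a property if some $A\in Q(\mathcal{A})$ has it, and requires a property if every $A\in Q(\mathcal{A})$ has it. A pattern is reducible if it is permutationally similar to a block upper triangular pattern with two square (nonempty) diagonal blocks, and irreducible otherwise; equivalently, irreducible means that the digraph with an arc $v_i\to v_j$ whenever $\mathcal{A}_{ij}\neq0$ is strongly connected. *)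

theory Defs
  imports "HOL-Combinatorics.Permutations" "Jordan_Normal_Form.Matrix"
begin

text \<open>Matrices are those of \<^theory>\<open>Jordan_Normal_Form.Matrix\<close>, so row and column indices run
  over \<open>0, \<dots>, n - 1\<close>; the vertices $1, 2, 3$ of a $3\times 3$ pattern are \<open>0, 1, 2\<close> here.\<close>

definition hadamard_mat :: "'a::times mat \<Rightarrow> 'a mat \<Rightarrow> 'a mat" where
  "hadamard_mat A B = mat (dim_row A) (dim_col A) (\<lambda>(i, j). A $$ (i, j) * B $$ (i, j))"

definition trace_mat :: "'a::comm_monoid_add mat \<Rightarrow> 'a" where
  "trace_mat A = (\<Sum>i<dim_row A. A $$ (i, i))"

definition nSMP :: "real mat \<Rightarrow> bool" where
  "nSMP A \<longleftrightarrow> square_mat A \<and>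
    (let n = dim_row A in
      \<forall>X \<in> carrier_mat n n.
        hadamard_mat A X = 0\<^sub>m n n \<longrightarrow>
        A * transpose_mat X - transpose_mat X * A = 0\<^sub>m n n \<longrightarrow>
        (\<forall>k<n. trace_mat (transpose_mat X * (A ^\<^sub>m k)) = 0) \<longrightarrow>
        X = 0\<^sub>m n n)"

datatype sign = Pos | Neg | Zero

fun sign_mult :: "sign \<Rightarrow> sign \<Rightarrow> sign" where
  "sign_mult Zero t = Zero"
| "sign_mult Pos t = t"
| "sign_mult Neg Pos = Neg"
| "sign_mult Neg Neg = Pos"
| "sign_mult Neg Zero = Zero"

definition opposite_signs :: "sign \<Rightarrow> sign \<Rightarrow> bool" where
  "opposite_signs s t \<longleftrightarrow> s = Pos \<and> t = Neg \<or> s = Neg \<and> t = Pos"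

definition qualitative_class :: "sign mat \<Rightarrow> real mat set" where
  "qualitative_class P = {A \<in> carrier_mat (dim_row P) (dim_col P).
     \<forall>i < dim_row P. \<forall>j < dim_col P.
       (P $$ (i, j) = Pos \<longrightarrow> A $$ (i, j) > 0) \<and>
       (P $$ (i, j) = Neg \<longrightarrow> A $$ (i, j) < 0) \<and>
       (P $$ (i, j) = Zero \<longrightarrow> A $$ (i, j) = 0)}"

definition pattern_allows :: "sign mat \<Rightarrow> (real mat \<Rightarrow> bool) \<Rightarrow> bool" where
  "pattern_allows P prop \<longleftrightarrow> (\<exists>A \<in> qualitative_class P. prop A)"

definition pattern_requires :: "sign mat \<Rightarrow> (real mat \<Rightarrow> bool) \<Rightarrow> bool" where
  "pattern_requires P prop \<longleftrightarrow> (\<forall>A \<in> qualitative_class P. prop A)"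

definition perm_similar :: "'a mat \<Rightarrow> 'a mat \<Rightarrow> bool" where
  "perm_similar P R \<longleftrightarrow> square_mat P \<and>
    (\<exists>p. p permutes {..<dim_row P} \<and>
         R = mat (dim_row P) (dim_row P) (\<lambda>(i, j). P $$ (p i, p j)))"

text \<open>The two square diagonal blocks have the positive sizes \<open>m\<close> and \<open>n - m\<close>.\<close>

definition two_block_upper_triangular :: "sign mat \<Rightarrow> bool" where
  "two_block_upper_triangular P \<longleftrightarrow> square_mat P \<and>
    (\<exists>m. 0 < m \<and> m < dim_row P \<and>
         (\<forall>i j. m \<le> i \<longrightarrow> i < dim_row P \<longrightarrow> j < m \<longrightarrow> P $$ (i, j) = Zero))"

definition reducible_pattern :: "sign mat \<Rightarrow> bool" where
  "reducible_pattern P \<longleftrightarrow> (\<exists>R. perm_similar P R \<and> two_block_upper_triangular R)"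

definition irreducible_pattern :: "sign mat \<Rightarrow> bool" where
  "irreducible_pattern P \<longleftrightarrow> square_mat P \<and> \<not> reducible_pattern P"

definition exceptional_pattern :: "sign mat \<Rightarrow> bool" where
  "exceptional_pattern P \<longleftrightarrow> P \<in> carrier_mat 3 3 \<and>
    (\<exists>R. perm_similar P R \<and>
      R $$ (1, 1) = Zero \<and> R $$ (2, 2) = Zero \<and> R $$ (1, 2) = Zero \<and> R $$ (2, 1) = Zero \<and>
      R $$ (0, 1) \<noteq> Zero \<and> R $$ (1, 0) \<noteq> Zero \<and> R $$ (0, 2) \<noteq> Zero \<and> R $$ (2, 0) \<noteq> Zero \<and>
      opposite_signs (sign_mult (R $$ (0, 1)) (R $$ (1, 0)))
                     (sign_mult (R $$ (0, 2)) (R $$ (2, 0))))"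

end

theory Submission
  imports Defs
begin

text \<open>Put \<open>Y = X\<^sup>T\<close>; the nSMP asks that a matrix \<open>Y\<close> commuting with \<open>A\<close>, vanishing wherever
  \<open>A\<^sup>T\<close> does not, and trace-orthogonal to \<open>1\<close> and \<open>A\<^sup>2\<close>, is zero. A strongly connected digraph on
  three vertices contains a 3-cycle or is a star with two 2-cycles.

  With a 3-cycle, only the diagonal of \<open>Y\<close> and its entries on that cycle can be nonzero. The latter
  vanish by commutation if some reverse arc is present; otherwise they are proportional to those of
  \<open>A\<close>, so that \<open>tr (Y A\<^sup>2) = 0\<close> kills them. Then \<open>Y\<close> is scalar of trace zero.

  For a star with 2-cycle products \<open>\<alpha>\<close> and \<open>\<beta>\<close>, the entries of \<open>Y\<close> are determined by its diagonal
  \<open>(p, q, r)\<close>, and the remaining conditions reduce to \<open>p = 0\<close>, \<open>r = - q\<close>, \<open>(\<alpha> + \<beta>) q = 0\<close> and the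
  vanishing of \<open>q\<close> in the presence of a non-centre loop. Hence the nSMP fails exactly when
  \<open>\<alpha> + \<beta> = 0\<close> and there is no such loop.\<close>

section \<open>The nSMP of a 3 by 3 matrix in coordinates\<close>

text \<open>The function \<open>y\<close> holds the entries of \<open>transpose_mat X\<close>. The
  trace condition for \<open>k = 1\<close> follows from the Hadamard condition, since that trace is
  the sum of the entries of \<open>hadamard_mat A X\<close>. The double sum is the condition for
  \<open>k = 2\<close>.\<close>

lemma nSMP_3_iff:
  assumes A: "A \<in> carrier_mat 3 3"
  shows "nSMP A \<longleftrightarrow> (\<forall>y :: nat \<Rightarrow> nat \<Rightarrow> real.
    (\<forall>i\<in>{..<3}. \<forall>j\<in>{..<3}. A $$ (i, j) * y j i = 0) \<longrightarrow>
    (\<forall>i\<in>{..<3}. \<forall>j\<in>{..<3}. (\<Sum>k<3. A $$ (i, k) * y k j) = (\<Sum>k<3. y i k * A $$ (k, j))) \<longrightarrow>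
    (\<Sum>i<3. y i i) = 0 \<longrightarrow>
    (\<Sum>i<3. \<Sum>j<3. y i j * (\<Sum>k<3. A $$ (j, k) * A $$ (k, i))) = 0 \<longrightarrow>
    (\<forall>i\<in>{..<3}. \<forall>j\<in>{..<3}. y i j = 0))"
    (is "_ \<longleftrightarrow> (\<forall>y. ?H y \<longrightarrow> ?C y \<longrightarrow> ?T0 y \<longrightarrow> ?T2 y \<longrightarrow> ?Z y)")
proof -
  define P where "P X \<longleftrightarrow> hadamard_mat A X = 0\<^sub>m 3 3 \<and>
    A * transpose_mat X - transpose_mat X * A = 0\<^sub>m 3 3 \<and>
    (\<forall>k<3. trace_mat (transpose_mat X * (A ^\<^sub>m k)) = 0)" for X
  have dim: "dim_row A = 3" "dim_col A = 3" using A by auto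
  have key: "P X \<longleftrightarrow> ?H (\<lambda>i j. X $$ (j, i)) \<and> ?C (\<lambda>i j. X $$ (j, i)) \<and> ?T0 (\<lambda>i j. X $$ (j, i)) \<and>
      ?T2 (\<lambda>i j. X $$ (j, i))" if X: "X \<in> carrier_mat 3 3" for X
  proof -
    have X': "dim_row X = 3" "dim_col X = 3" using X by auto
    have had: "hadamard_mat A X = 0\<^sub>m 3 3 \<longleftrightarrow> ?H (\<lambda>i j. X $$ (j, i))"
      by (auto simp: hadamard_mat_def mat_eq_iff dim)
    have com: "A * transpose_mat X - transpose_mat X * A = 0\<^sub>m 3 3 \<longleftrightarrow> ?C (\<lambda>i j. X $$ (j, i))"
      by (auto simp: mat_eq_iff dim X' scalar_prod_def atLeast0LessThan)
    have pow: "A ^\<^sub>m 0 = 1\<^sub>m 3" "A ^\<^sub>m 1 = A" "A ^\<^sub>m 2 = A * A"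
      using A by (auto simp: numeral_2_eq_2)
    have t0: "trace_mat (transpose_mat X * (A ^\<^sub>m 0)) = 0 \<longleftrightarrow> ?T0 (\<lambda>i j. X $$ (j, i))"
      using X unfolding pow by (simp add: trace_mat_def)
    have t1: "trace_mat (transpose_mat X * (A ^\<^sub>m 1)) = 0" if "?H (\<lambda>i j. X $$ (j, i))"
      using that unfolding pow
      by (auto simp: trace_mat_def dim X' scalar_prod_def atLeast0LessThan mult.commute
          intro!: sum.neutral)
    have t2: "trace_mat (transpose_mat X * (A ^\<^sub>m 2)) = 0 \<longleftrightarrow> ?T2 (\<lambda>i j. X $$ (j, i))"
      unfolding pow by (simp add: trace_mat_def dim X' scalar_prod_def atLeast0LessThan)
    have lt3: "(\<forall>k<3. Q k) \<longleftrightarrow> Q 0 \<and> Q 1 \<and> Q 2" for Q :: "nat \<Rightarrow> bool"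
      by (auto simp: less_Suc_eq numeral_3_eq_3 numeral_2_eq_2)
    show ?thesis
      unfolding P_def lt3 had com t0 t2 using t1 by blast
  qed
  have nSMP: "nSMP A \<longleftrightarrow> (\<forall>X \<in> carrier_mat 3 3. P X \<longrightarrow> X = 0\<^sub>m 3 3)"
    by (auto simp: nSMP_def P_def dim Let_def)
  show ?thesis
  proof
    assume L: "nSMP A"
    show "\<forall>y. ?H y \<longrightarrow> ?C y \<longrightarrow> ?T0 y \<longrightarrow> ?T2 y \<longrightarrow> ?Z y"
    proof (intro allI impI)
      fix y assume y: "?H y" "?C y" "?T0 y" "?T2 y"
      define X where "X = mat 3 3 (\<lambda>(i, j). y j i)"
      have X: "X \<in> carrier_mat 3 3" by (simp add: X_def)
      have "P X"
        unfolding key[OF X] using y by (simp add: X_def)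
      with L X have "X = 0\<^sub>m 3 3" unfolding nSMP by blast
      then show "?Z y" by (auto simp: X_def mat_eq_iff)
    qed
  next
    assume R: "\<forall>y. ?H y \<longrightarrow> ?C y \<longrightarrow> ?T0 y \<longrightarrow> ?T2 y \<longrightarrow> ?Z y"
    show "nSMP A"
      unfolding nSMP
    proof (intro ballI impI)
      fix X :: "real mat" assume X: "X \<in> carrier_mat 3 3" and "P X"
      then have "?Z (\<lambda>i j. X $$ (j, i))"
        using R[rule_format, of "\<lambda>i j. X $$ (j, i)"] key[OF X] by simp
      with X show "X = 0\<^sub>m 3 3" by (auto simp: mat_eq_iff)
    qed
  qed
qed

text \<open>A labelling of the three vertices. The set equation forces distinctness by cardinality,
  and it rewrites quantifiers over \<open>{..<3}\<close> into cases at \<open>i\<close>,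
  \<open>j\<close>, \<open>k\<close>, so that the algebra runs in any labelling without permuting
  matrices.\<close>

definition index_triple :: "nat \<Rightarrow> nat \<Rightarrow> nat \<Rightarrow> bool" where
  "index_triple i j k \<longleftrightarrow> {..<3} = {i, j, k}"

lemma index_tripleD:
  assumes "index_triple i j k"
  shows "{..<3} = {i, j, k}" "i \<noteq> j" "i \<noteq> k" "j \<noteq> k" "i < 3" "j < 3" "k < 3"
proof -
  have *: "{..<3} = {i, j, k}" using assms by (simp add: index_triple_def)
  then have "card {i, j, k} = 3" by (metis card_lessThan)
  then show "i \<noteq> j" "i \<noteq> k" "j \<noteq> k" by (auto simp: card_insert_if split: if_splits)
  show "{..<3} = {i, j, k}" "i < 3" "j < 3" "k < 3" using * by auto
qed

lemma sum_index_triple: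
  assumes "index_triple i j k"
  shows "(\<Sum>x<3. f x) = f i + f j + (f k :: real)"
  using index_tripleD[OF assms] by (simp add: add.assoc)

section \<open>Matrices whose digraph contains a 3-cycle\<close>

text \<open>Along the cycle, \<open>A\<close> has diagonal \<open>a, b, c\<close>, forward entries
  \<open>x, y, z\<close> and reverse entries \<open>d, e, f\<close>; \<open>Y\<close> has diagonal
  \<open>p, q, r\<close> and forward entries \<open>u, v, w\<close>. The equations
  \<open>fwd\<close> and \<open>bwd\<close> are commutation at the forward and at the reverse
  positions.\<close>

lemma cycle_algebra:
  fixes a b c d e f p q r u v w x y z :: real
  assumes nz: "x \<noteq> 0" "y \<noteq> 0" "z \<noteq> 0"
    and loops: "a * p = 0" "b * q = 0" "c * r = 0"
    and rev: "d * u = 0" "e * v = 0" "f * w = 0"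
    and fwd: "x * (q - p) + (a - b) * u = 0" "y * (r - q) + (b - c) * v = 0"
      "z * (p - r) + (c - a) * w = 0"
    and bwd: "y * w - z * v + d * (p - q) = 0" "z * u - x * w + e * (q - r) = 0"
      "x * v - y * u + f * (r - p) = 0"
    and tr: "p + q + r = 0"
    and tr2: "p * (a * a + x * d + f * z) + q * (d * x + b * b + y * e) + r * (z * f + e * y + c * c)
      + u * (d * a + b * d + y * z) + v * (z * x + e * b + c * e) + w * (a * f + x * y + f * c) = 0"
  shows "p = 0 \<and> q = 0 \<and> r = 0 \<and> u = 0 \<and> v = 0 \<and> w = 0"
proof -
  have "u = 0 \<and> v = 0 \<and> w = 0"
  proof (cases "d = 0 \<and> e = 0 \<and> f = 0")
    case True
    \<comment> \<open>Without reverse arcs, \<open>bwd\<close> makes \<open>(u, v, w)\<close> a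
      multiple of \<open>(x, y, z)\<close>.\<close>
    have v: "v = y * u / x" and w: "w = z * u / x"
      using bwd nz True by (simp_all add: field_simps)
    have "p * (a * a) = 0" "q * (b * b) = 0" "r * (c * c) = 0" using loops by auto
    then have "u * (y * z) + v * (z * x) + w * (x * y) = 0"
      using tr2 True by (simp del: mult_eq_0_iff)
    \<comment> \<open>By proportionality the three summands are equal.\<close>
    then have "3 * (u * (y * z)) = 0" using nz unfolding v w by (simp add: field_simps)
    then have "u = 0" using nz by simp
    then show ?thesis using v w by simp
  next
    case False
    then consider "d \<noteq> 0" | "e \<noteq> 0" | "f \<noteq> 0" by blast
    then show ?thesis
    proof cases
      case 1
      then have u: "u = 0" using rev by simp
      then have "p = q" using fwd nz by simp
      \<comment> \<open>By \<open>rev\<close>, either \<open>v = 0\<close>, or \<open>e = 0\<close>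
        and the second equation of \<open>bwd\<close> gives \<open>w = 0\<close>. The first one is
        now \<open>y * w = z * v\<close>, so both vanish. The other two cases are cyclic shifts of
        this one.\<close>
      then show ?thesis using u rev bwd nz by auto
    next
      case 2
      then have v: "v = 0" using rev by simp
      then have "q = r" using fwd nz by simp
      then show ?thesis using v rev bwd nz by auto
    next
      case 3
      then have w: "w = 0" using rev by simp
      then have "r = p" using fwd nz by simp
      then show ?thesis using w rev bwd nz by auto
    qed
  qed
  moreover from this have "q = p" "r = q" using fwd nz by auto
  ultimately show ?thesis using tr by simp
qed

lemma nSMP_cycle:
  assumes A: "A \<in> carrier_mat 3 3" and ijk: "index_triple i j k"
    and nz: "A $$ (i, j) \<noteq> 0" "A $$ (j, k) \<noteq> 0" "A $$ (k, i) \<noteq> 0"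
  shows "nSMP A"
  unfolding nSMP_3_iff[OF A]
proof (intro allI impI)
  fix y :: "nat \<Rightarrow> nat \<Rightarrow> real"
  assume H: "\<forall>i\<in>{..<3}. \<forall>j\<in>{..<3}. A $$ (i, j) * y j i = 0"
    and C: "\<forall>i\<in>{..<3}. \<forall>j\<in>{..<3}. (\<Sum>k<3. A $$ (i, k) * y k j) = (\<Sum>k<3. y i k * A $$ (k, j))"
    and T0: "(\<Sum>i<3. y i i) = 0"
    and T2: "(\<Sum>i<3. \<Sum>j<3. y i j * (\<Sum>k<3. A $$ (j, k) * A $$ (k, i))) = 0"
  note sums = sum_index_triple[OF ijk]
  note cover = index_tripleD(1)[OF ijk]
  have z: "y j i = 0" "y k j = 0" "y i k = 0"
    using H nz unfolding cover by auto
  have rev: "A $$ (j, i) * y i j = 0" "A $$ (k, j) * y j k = 0" "A $$ (i, k) * y k i = 0"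
    and loops: "A $$ (i, i) * y i i = 0" "A $$ (j, j) * y j j = 0" "A $$ (k, k) * y k k = 0"
    using H unfolding cover by auto
  have "y i i = 0 \<and> y j j = 0 \<and> y k k = 0 \<and> y i j = 0 \<and> y j k = 0 \<and> y k i = 0"
  proof (rule cycle_algebra[OF nz loops rev])
    show "y i i + y j j + y k k = 0" using T0 unfolding sums .
  qed (use C[unfolded sums, unfolded cover] T2[unfolded sums] z in \<open>simp_all add: algebra_simps\<close>)
  then show "\<forall>i\<in>{..<3}. \<forall>j\<in>{..<3}. y i j = 0"
    using z unfolding cover by auto
qed

section \<open>Matrices whose digraph is a star\<close>

text \<open>In \<open>A\<close>, \<open>b, c\<close> lead from the centre to the leaves,
  \<open>d, f\<close> lead back, and \<open>e, g\<close> are the leaf loops; \<open>Y\<close> has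
  diagonal \<open>p, q, r\<close> and entries \<open>v, w\<close> between the leaves.\<close>

lemma star_algebra:
  fixes b c d e f g p q r v w :: real
  assumes nz: "b \<noteq> 0" "c \<noteq> 0" "d \<noteq> 0"
    and loops: "e * q = 0" "g * r = 0"
    and com: "b * (q - p) + c * w = 0" "b * v + c * (r - p) = 0"
      "d * (q - p) + f * v = 0" "d * w + f * (r - p) = 0"
    and tr: "p + q + r = 0"
    and tr2: "p * (b * d + c * f) + q * (b * d) + r * (c * f) + v * (b * f) + w * (c * d) = 0"
    and ne: "b * d + c * f \<noteq> 0 \<or> e \<noteq> 0 \<or> g \<noteq> 0"
  shows "p = 0 \<and> q = 0 \<and> r = 0 \<and> v = 0 \<and> w = 0"
proof -
  \<comment> \<open>This combination eliminates \<open>w\<close> from the first and the last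
    commutation equation.\<close>
  have "d * (b * (q - p) + c * w) - c * (d * w + f * (r - p)) = 0"
    using com by simp
  then have 1: "b * d * (q - p) = c * f * (r - p)"
    by (simp add: algebra_simps)
  \<comment> \<open>Subtracting multiples of the last two commutation equations removes
    \<open>v\<close> and \<open>w\<close> from \<open>tr2\<close>.\<close>
  have "p * (b * d + c * f) + q * (b * d) + r * (c * f) + v * (b * f) + w * (c * d)
      - b * (d * (q - p) + f * v) - c * (d * w + f * (r - p)) = 0"
    using com tr2 by simp
  then have 2: "2 * (p * (b * d + c * f)) = 0"
    by (simp add: algebra_simps)
  have 3: "p = 0 \<and> q = 0 \<and> r = 0"
  proof (cases "b * d + c * f = 0")
    case True
    then have "c * f = - (b * d)" by simp
    with 1 have "(b * d) * (q + r - 2 * p) = 0" by (simp add: algebra_simps)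
    then have "q + r - 2 * p = 0" using nz by simp
    \<comment> \<open>Together with \<open>tr\<close> the equation reads
      \<open>3 * p = 0\<close>.\<close>
    with tr have "p = 0" "r = - q" by simp_all
    moreover have "q = 0" using True ne loops \<open>r = - q\<close> by auto
    ultimately show ?thesis by simp
  next
    case False
    then have p: "p = 0" using 2 by simp
    then have r: "r = - q" using tr by simp
    have "q * (b * d + c * f) = 0" using 1 unfolding p r by (simp add: algebra_simps)
    then show ?thesis using False p r by simp
  qed
  then show ?thesis using com nz by simp
qed

lemma nSMP_star_iff:
  assumes A: "A \<in> carrier_mat 3 3" and ijk: "index_triple i j k"
    and nz: "A $$ (i, j) \<noteq> 0" "A $$ (j, i) \<noteq> 0" "A $$ (i, k) \<noteq> 0" "A $$ (k, i) \<noteq> 0"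
    and z: "A $$ (j, k) = 0" "A $$ (k, j) = 0"
  shows "nSMP A \<longleftrightarrow> A $$ (i, j) * A $$ (j, i) + A $$ (i, k) * A $$ (k, i) \<noteq> 0 \<or>
    A $$ (j, j) \<noteq> 0 \<or> A $$ (k, k) \<noteq> 0" (is "_ \<longleftrightarrow> ?ne")
proof
  note sums = sum_index_triple[OF ijk]
  note cover = index_tripleD(1)[OF ijk]
  note ne = index_tripleD(2-4)[OF ijk]
  show ?ne if "nSMP A"
  proof (rule ccontr)
    assume "\<not> ?ne"
    then have 0: "A $$ (i, j) * A $$ (j, i) = - (A $$ (i, k) * A $$ (k, i))"
      "A $$ (j, j) = 0" "A $$ (k, k) = 0" by (auto simp: algebra_simps)
    \<comment> \<open>The diagonal is \<open>(0, 1, -1)\<close> in the order \<open>i, j, k\<close>;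
      the entries at \<open>(k, j)\<close> and \<open>(j, k)\<close> are solved from commutation at
      \<open>(i, j)\<close> and \<open>(j, i)\<close>.\<close>
    define y where "y s t = (if s = j \<and> t = j then 1 else if s = k \<and> t = k then -1
      else if s = j \<and> t = k then - A $$ (j, i) / A $$ (k, i)
      else if s = k \<and> t = j then - A $$ (i, j) / A $$ (i, k) else 0)" for s t
    have y: "y i i = 0" "y i j = 0" "y i k = 0" "y j i = 0" "y k i = 0" "y j j = 1" "y k k = -1"
      "y j k = - A $$ (j, i) / A $$ (k, i)" "y k j = - A $$ (i, j) / A $$ (i, k)"
      using ne by (auto simp: y_def)
    have "y j k * A $$ (i, j) = - (A $$ (i, j) * A $$ (j, i)) / A $$ (k, i)"
      "y k j * A $$ (j, i) = - (A $$ (i, j) * A $$ (j, i)) / A $$ (i, k)"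
      using y by (simp_all add: mult.commute)
    \<comment> \<open>Because the 2-cycle products cancel, the same entries satisfy commutation at
      \<open>(i, k)\<close> and \<open>(k, i)\<close>.\<close>
    then have y': "y j k * A $$ (i, j) = A $$ (i, k)" "y k j * A $$ (j, i) = A $$ (k, i)"
      using nz unfolding 0 by simp_all
    have y'': "y j k * (A $$ (i, j) * A $$ (k, i)) = A $$ (i, k) * A $$ (k, i)"
      "y k j * (A $$ (i, k) * A $$ (j, i)) = A $$ (i, k) * A $$ (k, i)"
      using y' by (metis mult.assoc, metis mult.left_commute)
    have "\<forall>s\<in>{..<3}. \<forall>t\<in>{..<3}. y s t = 0"
    proof (rule \<open>nSMP A\<close>[unfolded nSMP_3_iff[OF A], THEN spec, THEN mp, THEN mp, THEN mp, THEN mp])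
      show "\<forall>s\<in>{..<3}. \<forall>t\<in>{..<3}. A $$ (s, t) * y t s = 0"
        unfolding cover using y 0 z by simp
      show "\<forall>s\<in>{..<3}. \<forall>t\<in>{..<3}. (\<Sum>l<3. A $$ (s, l) * y l t) = (\<Sum>l<3. y s l * A $$ (l, t))"
        unfolding sums unfolding cover using y y' 0 z nz by (simp add: field_simps)
      show "(\<Sum>s<3. y s s) = 0"
        unfolding sums using y by simp
      \<comment> \<open>The diagonal of \<open>y\<close> contributes
        \<open>A $$ (i, k) * A $$ (k, i)\<close> with factor -2, and each of the two nonzero
        off-diagonal entries contributes it once.\<close>
      show "(\<Sum>s<3. \<Sum>t<3. y s t * (\<Sum>l<3. A $$ (t, l) * A $$ (l, s))) = 0"
        unfolding sums by (simp add: y(1-7) 0 z algebra_simps y'')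
    qed
    then show False using y unfolding cover by simp
  qed
  show "nSMP A" if ?ne
    unfolding nSMP_3_iff[OF A]
  proof (intro allI impI)
    fix y :: "nat \<Rightarrow> nat \<Rightarrow> real"
    assume H: "\<forall>i\<in>{..<3}. \<forall>j\<in>{..<3}. A $$ (i, j) * y j i = 0"
      and C: "\<forall>i\<in>{..<3}. \<forall>j\<in>{..<3}. (\<Sum>k<3. A $$ (i, k) * y k j) = (\<Sum>k<3. y i k * A $$ (k, j))"
      and T0: "(\<Sum>i<3. y i i) = 0"
      and T2: "(\<Sum>i<3. \<Sum>j<3. y i j * (\<Sum>k<3. A $$ (j, k) * A $$ (k, i))) = 0"
    have y: "y j i = 0" "y i j = 0" "y k i = 0" "y i k = 0"
      and loops: "A $$ (i, i) * y i i = 0" "A $$ (j, j) * y j j = 0" "A $$ (k, k) * y k k = 0"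
      using H nz unfolding cover by auto
    \<comment> \<open>These are the terms that the loops put into the second trace
      condition.\<close>
    have sq: "y i i * (A $$ (i, i) * A $$ (i, i)) = 0" "y j j * (A $$ (j, j) * A $$ (j, j)) = 0"
      "y k k * (A $$ (k, k) * A $$ (k, k)) = 0" using loops by auto
    have "y i i = 0 \<and> y j j = 0 \<and> y k k = 0 \<and> y j k = 0 \<and> y k j = 0"
    proof (rule star_algebra[OF nz(1,3,2) loops(2,3) _ _ _ _ _ _ that])
      show "y i i + y j j + y k k = 0" using T0 unfolding sums .
    qed (use C[unfolded sums, unfolded cover] T2[unfolded sums] y z sq in \<open>simp_all add: algebra_simps\<close>)
    then show "\<forall>i\<in>{..<3}. \<forall>j\<in>{..<3}. y i j = 0"
      using y unfolding cover by auto
  qed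
qed

section \<open>Permutation similarity, exceptional and irreducible patterns\<close>

lemma lessThan_3: "{..<3} = {0, 1, 2 :: nat}"
  by auto

lemma index_triple_permutes:
  assumes "index_triple i j k"
  obtains p where "p permutes {..<3}" "p 0 = i" "p 1 = j" "p 2 = k"
proof -
  let ?p = "\<lambda>x :: nat. if x = 0 then i else if x = 1 then j else if x = 2 then k else x"
  have "?p ` {..<3} = {i, j, k}" unfolding lessThan_3 by auto
  then have "?p ` {..<3} = {..<3}" using index_tripleD(1)[OF assms] by metis
  then have "bij_betw ?p {..<3} {..<3}"
    by (simp only: bij_betw_def eq_card_imp_inj_on finite_lessThan simp_thms)
  then have "?p permutes {..<3}"
    by (rule bij_imp_permutes) simp
  then show thesis by (rule that) simp_all
qed

lemma permutes_index_triple: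
  assumes "p permutes {..<3}"
  shows "index_triple (p 0) (p 1) (p 2)"
proof -
  have "p ` {..<3} = {p 0, p 1, p 2}" unfolding lessThan_3 by simp
  then show ?thesis using permutes_image[OF assms] by (simp add: index_triple_def)
qed

lemma perm_similar_3_iff:
  assumes "P \<in> carrier_mat 3 3"
  shows "perm_similar P R \<longleftrightarrow>
    (\<exists>p. p permutes {..<3} \<and> R = mat 3 3 (\<lambda>(i, j). P $$ (p i, p j)))"
  using assms by (auto simp: perm_similar_def)

text \<open>A permutation of the indices is the same as a labelling with centre \<open>i\<close>, so
  the condition can be read off \<open>P\<close> itself.\<close>

lemma exceptional_pattern_iff:
  assumes P: "P \<in> carrier_mat 3 3"
  shows "exceptional_pattern P \<longleftrightarrow> (\<exists>i j k. index_triple i j k \<and>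
    P $$ (j, j) = Zero \<and> P $$ (k, k) = Zero \<and> P $$ (j, k) = Zero \<and> P $$ (k, j) = Zero \<and>
    P $$ (i, j) \<noteq> Zero \<and> P $$ (j, i) \<noteq> Zero \<and> P $$ (i, k) \<noteq> Zero \<and> P $$ (k, i) \<noteq> Zero \<and>
    opposite_signs (sign_mult (P $$ (i, j)) (P $$ (j, i)))
                   (sign_mult (P $$ (i, k)) (P $$ (k, i))))"
    (is "_ \<longleftrightarrow> (\<exists>i j k. index_triple i j k \<and> ?E i j k)")
proof -
  have "exceptional_pattern P \<longleftrightarrow> (\<exists>p. p permutes {..<3} \<and> ?E (p 0) (p 1) (p 2))"
    unfolding exceptional_pattern_def perm_similar_3_iff[OF P] using P by auto
  also have "\<dots> \<longleftrightarrow> (\<exists>i j k. index_triple i j k \<and> ?E i j k)" (is "?L \<longleftrightarrow> ?R")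
  proof
    show ?R if ?L using that permutes_index_triple by blast
    assume ?R
    then obtain i j k where ijk: "index_triple i j k" and E: "?E i j k" by blast
    obtain p where "p permutes {..<3}" "p 0 = i" "p 1 = j" "p 2 = k"
      using index_triple_permutes[OF ijk] .
    with E show ?L by (intro exI[of _ p]) simp
  qed
  finally show ?thesis .
qed

text \<open>A vertex without outgoing arcs, listed last, gives a block triangular form with
  \<open>m = 2\<close>; one without incoming arcs, listed first, gives one with
  \<open>m = 1\<close>.\<close>

lemma irreducible_pattern_arcs:
  assumes P: "P \<in> carrier_mat 3 3" and irr: "irreducible_pattern P" and ijk: "index_triple i j k"
  shows "P $$ (i, j) \<noteq> Zero \<or> P $$ (i, k) \<noteq> Zero" "P $$ (j, i) \<noteq> Zero \<or> P $$ (k, i) \<noteq> Zero"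
proof -
  have no_block: False if p: "p permutes {..<3}" and "0 < m" "m < 3"
    and z: "\<And>s t. m \<le> s \<Longrightarrow> s < 3 \<Longrightarrow> t < m \<Longrightarrow> P $$ (p s, p t) = Zero" for p m
  proof -
    let ?R = "mat 3 3 (\<lambda>(i, j). P $$ (p i, p j))"
    have "perm_similar P ?R" using p perm_similar_3_iff[OF P] by blast
    moreover have "two_block_upper_triangular ?R"
      unfolding two_block_upper_triangular_def using that by (auto intro!: exI[of _ m])
    ultimately show False
      using irr by (auto simp: irreducible_pattern_def reducible_pattern_def)
  qed
  show "P $$ (j, i) \<noteq> Zero \<or> P $$ (k, i) \<noteq> Zero"
  proof (rule ccontr)
    assume "\<not> ?thesis"
    obtain p where "p permutes {..<3}" "p 0 = i" "p 1 = j" "p 2 = k"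
      using index_triple_permutes[OF ijk] .
    moreover from this \<open>\<not> ?thesis\<close> have "P $$ (p s, p t) = Zero" if "1 \<le> s" "s < 3" "t < 1" for s t
      using that by (auto simp: less_Suc_eq numeral_3_eq_3 numeral_2_eq_2)
    ultimately show False using no_block[of p 1] by simp
  qed
  show "P $$ (i, j) \<noteq> Zero \<or> P $$ (i, k) \<noteq> Zero"
  proof (rule ccontr)
    assume "\<not> ?thesis"
    have "index_triple j k i" using ijk by (auto simp: index_triple_def)
    then obtain p where "p permutes {..<3}" "p 0 = j" "p 1 = k" "p 2 = i"
      using index_triple_permutes by blast
    moreover from this \<open>\<not> ?thesis\<close> have "P $$ (p s, p t) = Zero" if "2 \<le> s" "s < 3" "t < 2" for s t
      using that by (auto simp: less_Suc_eq numeral_3_eq_3 numeral_2_eq_2)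
    ultimately show False using no_block[of p 2] by simp
  qed
qed

text \<open>A nonempty proper set of vertices is a single vertex or the complement of one, so the
  arc conditions amount to strong connectivity. Without a 3-cycle every non-loop arc lies on a
  2-cycle; connectivity needs two 2-cycles, and three would contain a 3-cycle.\<close>

lemma irreducible_pattern_cycle_or_star:
  assumes P: "P \<in> carrier_mat 3 3" and irr: "irreducible_pattern P"
  obtains (cycle) i j k where "index_triple i j k"
      "P $$ (i, j) \<noteq> Zero" "P $$ (j, k) \<noteq> Zero" "P $$ (k, i) \<noteq> Zero"
    | (star) i j k where "index_triple i j k"
      "P $$ (i, j) \<noteq> Zero" "P $$ (j, i) \<noteq> Zero" "P $$ (i, k) \<noteq> Zero" "P $$ (k, i) \<noteq> Zero"
      "P $$ (j, k) = Zero" "P $$ (k, j) = Zero"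
proof -
  have T: "index_triple 0 1 2" "index_triple 1 2 0" "index_triple 2 0 1"
    "index_triple 0 2 1" "index_triple 2 1 0" "index_triple 1 0 2"
    by (auto simp: index_triple_def)
  note arcs = irreducible_pattern_arcs[OF P irr T(1)] irreducible_pattern_arcs[OF P irr T(2)]
    irreducible_pattern_arcs[OF P irr T(3)]
  show thesis
    using arcs T cycle star by metis
qed

section \<open>Signs of the entries of a realisation\<close>

lemma qualitative_class_entry:
  assumes "A \<in> qualitative_class P" "P \<in> carrier_mat n n" "i < n" "j < n"
  shows "P $$ (i, j) = Pos \<Longrightarrow> A $$ (i, j) > 0" "P $$ (i, j) = Neg \<Longrightarrow> A $$ (i, j) < 0"
    "P $$ (i, j) = Zero \<longleftrightarrow> A $$ (i, j) = 0"
proof -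
  show "P $$ (i, j) = Pos \<Longrightarrow> A $$ (i, j) > 0" "P $$ (i, j) = Neg \<Longrightarrow> A $$ (i, j) < 0"
    using assms by (auto simp: qualitative_class_def)
  moreover have "P $$ (i, j) = Zero \<Longrightarrow> A $$ (i, j) = 0"
    using assms by (auto simp: qualitative_class_def)
  ultimately show "P $$ (i, j) = Zero \<longleftrightarrow> A $$ (i, j) = 0"
    by (cases "P $$ (i, j)") auto
qed

text \<open>Nonzero signs that are not opposite are equal, and two reals of the same strict sign
  cannot cancel.\<close>

lemma qualitative_class_same_signed_products:
  assumes A: "A \<in> qualitative_class P" and P: "P \<in> carrier_mat n n" and ijk: "i < n" "j < n" "k < n"
    and nz: "P $$ (i, j) \<noteq> Zero" "P $$ (j, i) \<noteq> Zero" "P $$ (i, k) \<noteq> Zero" "P $$ (k, i) \<noteq> Zero"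
    and same: "\<not> opposite_signs (sign_mult (P $$ (i, j)) (P $$ (j, i)))
                  (sign_mult (P $$ (i, k)) (P $$ (k, i)))"
  shows "A $$ (i, j) * A $$ (j, i) + A $$ (i, k) * A $$ (k, i) \<noteq> 0"
proof -
  have sgn: "sign_mult (P $$ (s, t)) (P $$ (t, s)) = Pos \<and> A $$ (s, t) * A $$ (t, s) > 0 \<or>
      sign_mult (P $$ (s, t)) (P $$ (t, s)) = Neg \<and> A $$ (s, t) * A $$ (t, s) < 0"
    if "s < n" "t < n" "P $$ (s, t) \<noteq> Zero" "P $$ (t, s) \<noteq> Zero" for s t
    using that qualitative_class_entry[OF A P that(1,2)] qualitative_class_entry[OF A P that(2,1)]
    by (cases "P $$ (s, t)"; cases "P $$ (t, s)")
      (auto intro: mult_pos_pos mult_neg_neg mult_pos_neg mult_neg_pos)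
  show ?thesis
    using sgn[OF ijk(1,2) nz(1,2)] sgn[OF ijk(1,3) nz(3,4)] same
    by (auto simp: opposite_signs_def)
qed

section \<open>Realisations of an exceptional pattern with prescribed magnitudes\<close>

fun real_of_sign :: "sign \<Rightarrow> real" where
  "real_of_sign Pos = 1"
| "real_of_sign Neg = - 1"
| "real_of_sign Zero = 0"

lemma real_of_sign_mult: "real_of_sign (sign_mult s t) = real_of_sign s * real_of_sign t"
  by (cases s; cases t) auto

lemma real_of_sign_eq_0_iff: "real_of_sign s = 0 \<longleftrightarrow> s = Zero"
  by (cases s) auto

definition weighted_pattern :: "(nat \<times> nat \<Rightarrow> real) \<Rightarrow> sign mat \<Rightarrow> real mat" where
  "weighted_pattern h P = mat (dim_row P) (dim_col P) (\<lambda>x. h x * real_of_sign (P $$ x))"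

lemma weighted_pattern_qualitative_class:
  assumes "\<And>x. h x > 0"
  shows "weighted_pattern h P \<in> qualitative_class P"
  using assms by (auto simp: weighted_pattern_def qualitative_class_def)

text \<open>With unit weights the two 2-cycle products are 1 and -1 and cancel. Changing the weight
  of the single arc from the centre \<open>i\<close> to the leaf \<open>j\<close> upsets this
  balance.\<close>

lemma exceptional_pattern_weighted_nSMP:
  assumes P: "P \<in> carrier_mat 3 3" and exc: "exceptional_pattern P"
  obtains i j where "\<And>h. (\<And>x. h x > 0) \<Longrightarrow> (\<And>x. x \<noteq> (i, j) \<Longrightarrow> h x = 1) \<Longrightarrow>
    nSMP (weighted_pattern h P) \<longleftrightarrow> h (i, j) \<noteq> 1"
proof -
  obtain i j k where ijk: "index_triple i j k"
    and z: "P $$ (j, j) = Zero" "P $$ (k, k) = Zero" "P $$ (j, k) = Zero" "P $$ (k, j) = Zero"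
    and nz: "P $$ (i, j) \<noteq> Zero" "P $$ (j, i) \<noteq> Zero" "P $$ (i, k) \<noteq> Zero" "P $$ (k, i) \<noteq> Zero"
    and opp: "opposite_signs (sign_mult (P $$ (i, j)) (P $$ (j, i)))
                   (sign_mult (P $$ (i, k)) (P $$ (k, i)))"
    using exc unfolding exceptional_pattern_iff[OF P] by blast
  let ?r = "\<lambda>s t. real_of_sign (P $$ (s, t))"
  have r0: "?r i j * ?r j i = - (?r i k * ?r k i)"
    using opp unfolding opposite_signs_def real_of_sign_mult[symmetric] by auto
  show thesis
  proof (rule that)
    fix h :: "nat \<times> nat \<Rightarrow> real"
    assume pos: "\<And>x. h x > 0" and h: "\<And>x. x \<noteq> (i, j) \<Longrightarrow> h x = 1"
    define A where "A = weighted_pattern h P"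
    have A: "A \<in> carrier_mat 3 3" using P by (simp add: A_def weighted_pattern_def)
    have ent: "A $$ (s, t) = h (s, t) * ?r s t" if "s < 3" "t < 3" for s t
      using that P by (simp add: A_def weighted_pattern_def)
    note D = index_tripleD[OF ijk]
    have "h (i, j) \<noteq> 0" using pos[of "(i, j)"] by simp
    have "nSMP A \<longleftrightarrow> A $$ (i, j) * A $$ (j, i) + A $$ (i, k) * A $$ (k, i) \<noteq> 0 \<or>
        A $$ (j, j) \<noteq> 0 \<or> A $$ (k, k) \<noteq> 0"
      by (rule nSMP_star_iff[OF A ijk])
        (use nz z D h \<open>h (i, j) \<noteq> 0\<close> in \<open>simp_all add: ent real_of_sign_eq_0_iff\<close>)
    \<comment> \<open>Distinctness of the labels gives weight 1 to all the other entries
      involved.\<close>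
    also have "\<dots> \<longleftrightarrow> h (i, j) * (?r i j * ?r j i) + ?r i k * ?r k i \<noteq> 0"
      using z D h by (simp add: ent mult.assoc)
    also have "\<dots> \<longleftrightarrow> (1 - h (i, j)) * (?r i k * ?r k i) \<noteq> 0"
      unfolding r0 by (simp add: algebra_simps)
    also have "\<dots> \<longleftrightarrow> h (i, j) \<noteq> 1"
      using nz by (simp add: real_of_sign_eq_0_iff)
    finally show "nSMP (weighted_pattern h P) \<longleftrightarrow> h (i, j) \<noteq> 1" unfolding A_def .
  qed
qed

section \<open>Requiring and allowing the nSMP\<close>

theorem theorem6p2:
  fixes P :: "sign mat"
  assumes "P \<in> carrier_mat 3 3"
    and "irreducible_pattern P"
  shows "(\<not> exceptional_pattern P \<longrightarrow> pattern_requires P nSMP) \<and>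
         (exceptional_pattern P \<longrightarrow> pattern_allows P nSMP \<and> \<not> pattern_requires P nSMP)"
proof (intro conjI impI)
  note P = assms(1)
  assume ne: "\<not> exceptional_pattern P"
  show "pattern_requires P nSMP"
    unfolding pattern_requires_def
  proof
    fix A assume AP: "A \<in> qualitative_class P"
    then have A: "A \<in> carrier_mat 3 3" using P by (auto simp: qualitative_class_def)
    note zero = qualitative_class_entry(3)[OF AP P]
    show "nSMP A"
      using P assms(2)
    proof (cases rule: irreducible_pattern_cycle_or_star)
      case (cycle i j k)
      note D = index_tripleD[OF cycle(1)]
      show ?thesis
        by (rule nSMP_cycle[OF A cycle(1)]) (use cycle zero D in auto)
    next
      case (star i j k)
      note D = index_tripleD[OF star(1)]
      \<comment> \<open>A star that is not exceptional has a leaf loop or equally signed 2-cycles,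
        and either one survives in every realisation.\<close>
      have "P $$ (j, j) \<noteq> Zero \<or> P $$ (k, k) \<noteq> Zero \<or>
          \<not> opposite_signs (sign_mult (P $$ (i, j)) (P $$ (j, i)))
            (sign_mult (P $$ (i, k)) (P $$ (k, i)))"
        using ne star unfolding exceptional_pattern_iff[OF P] by blast
      then have "A $$ (i, j) * A $$ (j, i) + A $$ (i, k) * A $$ (k, i) \<noteq> 0 \<or>
          A $$ (j, j) \<noteq> 0 \<or> A $$ (k, k) \<noteq> 0"
        using qualitative_class_same_signed_products[OF AP P D(5-7) star(2-5)] zero D by blast
      moreover have "A $$ (i, j) \<noteq> 0" "A $$ (j, i) \<noteq> 0" "A $$ (i, k) \<noteq> 0" "A $$ (k, i) \<noteq> 0"
        "A $$ (j, k) = 0" "A $$ (k, j) = 0"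
        using star zero D by auto
      ultimately show ?thesis using nSMP_star_iff[OF A star(1)] by blast
    qed
  qed
next
  assume "exceptional_pattern P"
  then obtain i j where ij: "\<And>h. (\<And>x. h x > 0) \<Longrightarrow> (\<And>x. x \<noteq> (i, j) \<Longrightarrow> h x = 1) \<Longrightarrow>
      nSMP (weighted_pattern h P) \<longleftrightarrow> h (i, j) \<noteq> 1"
    using exceptional_pattern_weighted_nSMP[OF assms(1)] by metis
  \<comment> \<open>Any positive weight other than 1 would serve in place of 2.\<close>
  have "nSMP (weighted_pattern ((\<lambda>_. 1)((i, j) := 2)) P)" by (subst ij) auto
  then show "pattern_allows P nSMP"
    unfolding pattern_allows_def by (rule bexI) (rule weighted_pattern_qualitative_class, simp)
  have "\<not> nSMP (weighted_pattern (\<lambda>_. 1) P)" by (subst ij) auto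
  then show "\<not> pattern_requires P nSMP"
    unfolding pattern_requires_def using weighted_pattern_qualitative_class[of "\<lambda>_. 1" P] by auto
qed

end
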